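(* Let $ABC$ be a triangle with Nagel point $N_a$, and let the cevians through $N_a$ be $AD$, $BE$, $CF$, with $D$ on side $BC$, $E$ on side $CA$, $F$ on side $AB$. Let $r_1$ be the radius of the excircle of $\triangle BN_aD$ that touches side $BD$, $r_2$ the radius of the excircle of $\triangle CN_aD$ that touches side $DC$, $r_3$ the radius of the excircle of $\triangle CN_aE$ that touches side $CE$, $r_4$ the radius of the excircle of $\triangle AN_aE$ that touches side $EA$, $r_5$ the radius of the excircle of $\triangle AN_aF$ that touches side $AF$, and $r_6$ the radius of the excircle of $\triangle BN_aF$ that touches side $FB$. Then $$r_1r_3r_5=r_2r_4r_6.$$
   Context: If the excircles of $\triangle ABC$ touch the sides $BC$, $CA$, $AB$ at $D$, $E$, $F$ respectively (each being the excircle opposite the remaining vertex), then $AD$, $BE$, $CF$ are concurrent, and their common point is the Nagel point of $\triangle ABC$; so $D,E,F$ in the claim are these contact points. The excircle of a triangle that touches a given side is the circle tangent to that side (segment) and to the extensions of the other two sides, lying on the opposite side of that segment from the remaining vertex. *)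

theory Defs
  imports "HOL-Analysis.Analysis"
begin

type_synonym point = "real ^ 2"

text \<open>The line \<open>PQ\<close> is tangent to the circle with centre \<open>z\<close> and radius \<open>r\<close>, with \<open>T\<close> as the point
  of tangency.\<close>

definition tangent_at :: "point \<Rightarrow> point \<Rightarrow> point \<Rightarrow> real \<Rightarrow> point \<Rightarrow> bool" where
  "tangent_at P Q z r T \<longleftrightarrow> affine hull {P, Q} \<inter> sphere z r = {T}"

text \<open>The part of the ray from \<open>P\<close> through \<open>Q\<close> that lies beyond \<open>Q\<close>.\<close>

definition extension_beyond :: "point \<Rightarrow> point \<Rightarrow> point set" where
  "extension_beyond P Q = {P + t *\<^sub>R (Q - P) | t. t > 1}"

text \<open>The circle with centre \<open>z\<close> and radius \<open>r\<close> is the excircle of the triangle \<open>PQR\<close> that touches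
  the side \<open>QR\<close>, at \<open>T\<close>. The last conjunct says that the circle lies on the other side of the line
  \<open>QR\<close> from \<open>P\<close>; it is automatic for the point \<open>T\<close> itself, which is on that line.\<close>

definition excircle_at :: "point \<Rightarrow> point \<Rightarrow> point \<Rightarrow> point \<Rightarrow> real \<Rightarrow> point \<Rightarrow> bool" where
  "excircle_at P Q R z r T \<longleftrightarrow>
     r > 0 \<and>
     T \<in> closed_segment Q R \<and> tangent_at Q R z r T \<and>
     (\<exists>U \<in> extension_beyond P Q. tangent_at P Q z r U) \<and>
     (\<exists>V \<in> extension_beyond P R. tangent_at P R z r V) \<and>
     (\<forall>X \<in> sphere z r. closed_segment P X \<inter> affine hull {Q, R} \<noteq> {})"

text \<open>A relation rather than a function of the triangle: the excircle exists and is unique only when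
  \<open>P\<close>, \<open>Q\<close>, \<open>R\<close> are not collinear.\<close>

definition exradius :: "point \<Rightarrow> point \<Rightarrow> point \<Rightarrow> real \<Rightarrow> bool" where
  "exradius P Q R r \<longleftrightarrow> (\<exists>z T. excircle_at P Q R z r T)"

definition extouch_point :: "point \<Rightarrow> point \<Rightarrow> point \<Rightarrow> point \<Rightarrow> bool" where
  "extouch_point P Q R T \<longleftrightarrow> (\<exists>z r. excircle_at P Q R z r T)"

definition nagel_point :: "point \<Rightarrow> point \<Rightarrow> point \<Rightarrow> point \<Rightarrow> bool" where
  "nagel_point A B C N \<longleftrightarrow>
     (\<exists>D E F. extouch_point A B C D \<and> extouch_point B C A E \<and> extouch_point C A B F \<and>
        N \<in> closed_segment A D \<inter> closed_segment B E \<inter> closed_segment C F)"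

end

theory Submission
  imports Defs
begin

text \<open>Write \<open>k\<close> for the cosine of the angle at \<open>P\<close> of a triangle \<open>PQR\<close> and \<open>s\<close> for its semiperimeter.
  The excircle opposite \<open>P\<close> touches the lines \<open>PQ\<close> and \<open>PR\<close> at distance \<open>s\<close> from \<open>P\<close>, so its radius
  satisfies \<open>r\<^sup>2 (1 + k) = s\<^sup>2 (1 - k)\<close>. Hence the radii of two small triangles with vertical angles at
  \<open>N\<close> are proportional to their semiperimeters, and the claim becomes an identity between products of
  three perimeters. All lengths in it are explicit: with \<open>x, y, z = s - a, s - b, s - c\<close> the Nagel
  point has barycentric coordinates \<open>x : y : z\<close>, and Stewart's theorem gives the cevians by
  \<open>a AD\<^sup>2 = s (a s - 4 y z)\<close>. The perimeter identity follows from these three equations.\<close>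

section \<open>Tangent lines and tangent lengths\<close>

text \<open>Reflecting \<open>T\<close> in the foot of the perpendicular from \<open>z\<close> gives
  another common point of line and circle, which uniqueness of the contact point forces to be
  \<open>T\<close> itself.\<close>

lemma tangent_at_orthogonal:
  assumes "tangent_at P Q z r T"
  shows "(z - T) \<bullet> (Q - P) = 0"
proof (cases "Q = P")
  case False
  define d where "d = Q - P"
  define m where "m = 2 * ((z - T) \<bullet> d) / (d \<bullet> d)"
  have d: "d \<bullet> d \<noteq> 0" using False by (simp add: d_def)
  have T: "T \<in> affine hull {P, Q}" "dist z T = r"
    and uniq: "\<And>X. X \<in> affine hull {P, Q} \<Longrightarrow> dist z X = r \<Longrightarrow> X = T"
    using assms unfolding tangent_at_def by (auto simp: set_eq_iff)
  obtain u v where uv: "T = u *\<^sub>R P + v *\<^sub>R Q" "u + v = 1"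
    using T(1) by (auto simp: affine_hull_2)
  \<comment> \<open>the reflection of \<open>T\<close> in the foot of the perpendicular from \<open>z\<close>\<close>
  have "T + m *\<^sub>R d = (u - m) *\<^sub>R P + (v + m) *\<^sub>R Q"
    by (simp add: uv d_def algebra_simps)
  then have "T + m *\<^sub>R d \<in> affine hull {P, Q}"
    unfolding affine_hull_2 mem_Collect_eq using uv(2)
    by (intro exI[of _ "u - m"] exI[of _ "v + m"]) simp
  moreover have "(z - (T + m *\<^sub>R d)) \<bullet> (z - (T + m *\<^sub>R d))
      = (z - T) \<bullet> (z - T) - m * (2 * ((z - T) \<bullet> d) - m * (d \<bullet> d))"
    by (simp add: inner_diff_left inner_diff_right inner_add_left inner_add_right inner_commute
        algebra_simps)
  then have "dist z (T + m *\<^sub>R d) = r"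
    using T(2) d by (simp add: m_def dist_norm norm_eq_sqrt_inner)
  ultimately have "m *\<^sub>R d = 0" using uniq by fastforce
  then show ?thesis using d by (auto simp: m_def d_def)
qed simp

text \<open>Pythagoras with the radius to \<open>T\<close> as one leg. Having it for both points
  that name the line lets each vertex compare the two tangents through it.\<close>

lemma tangent_at_pythagoras:
  assumes "tangent_at P Q z r T"
  shows "(dist P z)\<^sup>2 = r\<^sup>2 + (dist P T)\<^sup>2" and "(dist Q z)\<^sup>2 = r\<^sup>2 + (dist Q T)\<^sup>2"
proof -
  have T: "T \<in> affine hull {P, Q}" "dist z T = r"
    using assms unfolding tangent_at_def by (auto simp: set_eq_iff)
  obtain u v where uv: "T = u *\<^sub>R P + v *\<^sub>R Q" "u + v = 1"
    using T(1) by (auto simp: affine_hull_2)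
  have orth: "orthogonal (T - z) (c *\<^sub>R (Q - P))" for c
    using tangent_at_orthogonal[OF assms]
    by (simp add: orthogonal_def inner_diff_left)
  have u: "u = 1 - v" using uv(2) by simp
  have P: "P - T = (- v) *\<^sub>R (Q - P)" and Q: "Q - T = (1 - v) *\<^sub>R (Q - P)"
    unfolding uv(1) u by (simp_all add: algebra_simps)
  have "(norm ((T - z) + (P - T)))\<^sup>2 = (norm (T - z))\<^sup>2 + (norm (P - T))\<^sup>2"
    unfolding P by (rule norm_add_Pythagorean[OF orth])
  then show "(dist P z)\<^sup>2 = r\<^sup>2 + (dist P T)\<^sup>2"
    using T(2) by (simp add: dist_norm norm_minus_commute)
  have "(norm ((T - z) + (Q - T)))\<^sup>2 = (norm (T - z))\<^sup>2 + (norm (Q - T))\<^sup>2"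
    unfolding Q by (rule norm_add_Pythagorean[OF orth])
  then show "(dist Q z)\<^sup>2 = r\<^sup>2 + (dist Q T)\<^sup>2"
    using T(2) by (simp add: dist_norm norm_minus_commute)
qed

lemma extension_beyondD:
  assumes "U \<in> extension_beyond P Q"
  shows "dist P U = dist P Q + dist Q U" and "U - P = dist P U *\<^sub>R sgn (Q - P)"
proof -
  obtain t where t: "U = P + t *\<^sub>R (Q - P)" "t > 1"
    using assms by (auto simp: extension_beyond_def)
  have "U - Q = (t - 1) *\<^sub>R (Q - P)" by (simp add: t(1) algebra_simps)
  then have "dist Q U = (t - 1) * dist P Q"
    using t(2) by (metis abs_of_pos diff_gt_0_iff_gt dist_commute dist_norm norm_scaleR)
  moreover have PU: "dist P U = t * dist P Q"
    using t by (simp add: dist_norm norm_minus_commute)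
  ultimately show "dist P U = dist P Q + dist Q U" by (simp add: algebra_simps)
  show "U - P = dist P U *\<^sub>R sgn (Q - P)"
    unfolding PU using t(1) by (cases "Q = P") (simp_all add: sgn_div_norm dist_norm norm_minus_commute)
qed

text \<open>Tangents from a common vertex are equally long, so \<open>dist Q U = dist Q T\<close>
  and \<open>dist R V = dist R T\<close>. Adding the two decompositions shows that
  \<open>dist P U\<close> is the semiperimeter.\<close>

lemma excircle_at_tangent_lengths:
  assumes "excircle_at P Q R z r T"
  obtains U V where "tangent_at P Q z r U" "tangent_at P R z r V"
    "U - P = dist P U *\<^sub>R sgn (Q - P)" "V - P = dist P V *\<^sub>R sgn (R - P)"
    "dist P U = dist P Q + dist Q T" "dist P V = dist P R + dist R T"
    "dist P U = dist P V" "dist Q T + dist R T = dist Q R"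
proof -
  obtain U V where UV: "U \<in> extension_beyond P Q" "tangent_at P Q z r U"
      "V \<in> extension_beyond P R" "tangent_at P R z r V"
    and T: "T \<in> closed_segment Q R" "tangent_at Q R z r T"
    using assms unfolding excircle_at_def by blast
  have eq: "dist a b = dist c d" if "(dist X z)\<^sup>2 = r\<^sup>2 + (dist a b)\<^sup>2" "(dist X z)\<^sup>2 = r\<^sup>2 + (dist c d)\<^sup>2"
    for X a b c d :: point
    using that by (simp add: power2_eq_iff_nonneg)
  have "dist Q U = dist Q T" "dist R V = dist R T" "dist P U = dist P V"
    using eq[OF tangent_at_pythagoras(2)[OF UV(2)] tangent_at_pythagoras(1)[OF T(2)]]
      eq[OF tangent_at_pythagoras(2)[OF UV(4)] tangent_at_pythagoras(2)[OF T(2)]]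
      eq[OF tangent_at_pythagoras(1)[OF UV(2)] tangent_at_pythagoras(1)[OF UV(4)]]
    by auto
  moreover have "dist Q T + dist R T = dist Q R"
    using T(1) by (simp add: between_mem_segment[symmetric] between dist_commute)
  ultimately show thesis
    using that[OF UV(2,4)] extension_beyondD[OF UV(1)] extension_beyondD[OF UV(3)] by metis
qed

section \<open>The half-angle formula for the exradius\<close>

lemma inner_vec2: "(v :: real ^ 2) \<bullet> w = v $ 1 * w $ 1 + v $ 2 * w $ 2"
  by (simp add: inner_vec_def sum_2)

text \<open>In the plane, a vector orthogonal to \<open>u - v\<close> is parallel to \<open>u + v\<close>.\<close>

lemma inner_self_of_equal_projections:
  fixes u v w :: "real ^ 2"
  assumes "norm u = 1" "norm v = 1" "u \<noteq> v" "w \<bullet> u = s" "w \<bullet> v = s"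
  shows "(1 + u \<bullet> v) * (w \<bullet> w) = 2 * s\<^sup>2"
proof -
  define e f where "e = u + v" and "f = u - v"
  have uu: "u \<bullet> u = 1" "v \<bullet> v = 1" using assms(1,2) by (simp_all add: norm_eq_1)
  have ef: "e \<bullet> f = 0" "w \<bullet> f = 0" "w \<bullet> e = 2 * s" "e \<bullet> e = 2 * (1 + u \<bullet> v)"
    using assms(4,5) uu
    by (simp_all add: e_def f_def inner_diff_right inner_add_left inner_add_right inner_commute)
  have f: "f \<bullet> f \<noteq> 0" using assms(3) by (simp add: f_def)
  \<comment> \<open>Both \<open>w\<close> and \<open>e\<close> are orthogonal to the nonzero vector
    \<open>f\<close>, so in the plane their cross product vanishes; the identity makes this
    explicit.\<close>
  have "(w $ 1 * e $ 2 - w $ 2 * e $ 1) * (f \<bullet> f)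
      = (e $ 2 * f $ 1 - e $ 1 * f $ 2) * (w \<bullet> f) + (w $ 1 * f $ 2 - w $ 2 * f $ 1) * (e \<bullet> f)"
    unfolding inner_vec2 by algebra
  then have cross: "w $ 1 * e $ 2 - w $ 2 * e $ 1 = 0" using ef f by simp
  \<comment> \<open>Lagrange's identity turns the parallelism of \<open>w\<close> and
    \<open>e\<close> into equality in Cauchy-Schwarz.\<close>
  have "(w \<bullet> w) * (e \<bullet> e) = (w \<bullet> e)\<^sup>2 + (w $ 1 * e $ 2 - w $ 2 * e $ 1)\<^sup>2"
    unfolding inner_vec2 by algebra
  then have "(w \<bullet> w) * (2 * (1 + u \<bullet> v)) = (2 * s)\<^sup>2" unfolding ef cross by simp
  then show ?thesis by (simp add: power_mult_distrib algebra_simps)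
qed

text \<open>This is the square of r = s tan(P/2). The contact points lie at distance
  \<open>s\<close> along both sides, so \<open>z - P\<close> has projection \<open>s\<close> on both
  directions, whence \<open>(1 + k) |z - P|^2 = 2 s^2\<close>; Pythagoras supplies
  \<open>|z - P|^2 = r^2 + s^2\<close>.\<close>

lemma exradius_half_angle:
  fixes P Q R :: point
  assumes "exradius P Q R r" "P \<noteq> Q" "P \<noteq> R" "sgn (Q - P) \<noteq> sgn (R - P)"
  defines "s \<equiv> (dist P Q + dist P R + dist Q R) / 2"
    and "k \<equiv> sgn (Q - P) \<bullet> sgn (R - P)"
  shows "r > 0" "1 + k > 0" "r\<^sup>2 * (1 + k) = s\<^sup>2 * (1 - k)"
proof -
  obtain z T where ex: "excircle_at P Q R z r T" using assms(1) by (auto simp: exradius_def)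
  then show "r > 0" by (simp add: excircle_at_def)
  obtain U V where UV: "tangent_at P Q z r U" "tangent_at P R z r V"
    "U - P = dist P U *\<^sub>R sgn (Q - P)" "V - P = dist P V *\<^sub>R sgn (R - P)"
    "dist P U = dist P Q + dist Q T" "dist P V = dist P R + dist R T"
    "dist P U = dist P V" "dist Q T + dist R T = dist Q R"
    by (rule excircle_at_tangent_lengths[OF ex])
  have s: "dist P U = s" "dist P V = s" using UV(5-8) by (simp_all add: s_def)
  have n: "norm (sgn (Q - P)) = 1" "norm (sgn (R - P)) = 1"
    using assms(2,3) by (simp_all add: norm_sgn)
  have "(z - U) \<bullet> sgn (Q - P) = 0" "(z - V) \<bullet> sgn (R - P) = 0"
    using tangent_at_orthogonal[OF UV(1)] tangent_at_orthogonal[OF UV(2)]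
    by (simp_all add: sgn_div_norm)
  moreover have "(U - P) \<bullet> sgn (Q - P) = s" "(V - P) \<bullet> sgn (R - P) = s"
    unfolding UV(3,4) s using n by (simp_all add: norm_eq_1)
  ultimately have "(z - P) \<bullet> sgn (Q - P) = s" "(z - P) \<bullet> sgn (R - P) = s"
    by (simp_all add: inner_diff_left)
  from inner_self_of_equal_projections[OF n assms(4) this]
  have eq: "(1 + k) * ((z - P) \<bullet> (z - P)) = 2 * s\<^sup>2" by (simp add: k_def)
  have "(z - P) \<bullet> (z - P) = r\<^sup>2 + s\<^sup>2"
    using tangent_at_pythagoras(1)[OF UV(1)] unfolding s
    by (simp add: dist_norm norm_minus_commute flip: power2_norm_eq_inner)
  with eq have eq': "(1 + k) * (r\<^sup>2 + s\<^sup>2) = 2 * s\<^sup>2" by simp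
  then show "r\<^sup>2 * (1 + k) = s\<^sup>2 * (1 - k)" by (simp add: algebra_simps)
  have "s > 0" using assms(2) unfolding s_def
    by (smt (verit) zero_less_dist_iff zero_le_dist half_gt_zero)
  then have "2 * s\<^sup>2 > 0" "r\<^sup>2 + s\<^sup>2 > 0" by (simp_all add: add_nonneg_pos)
  then show "1 + k > 0" using eq' by (metis zero_less_mult_pos2)
qed

section \<open>Triangles with vertical angles\<close>

lemma sgn_eq_imp_collinear:
  fixes P Q R :: "'a :: real_inner"
  assumes "P \<noteq> Q" "P \<noteq> R" "sgn (Q - P) = sgn (R - P)"
  shows "collinear {P, Q, R}"
proof -
  have "R - P = norm (R - P) *\<^sub>R sgn (R - P)"
    using assms(2) by (simp add: sgn_div_norm)
  also have "\<dots> = (norm (R - P) / norm (Q - P)) *\<^sub>R (Q - P)"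
    unfolding assms(3)[symmetric] by (simp add: sgn_div_norm divide_inverse)
  finally have "R - P = (norm (R - P) / norm (Q - P)) *\<^sub>R (Q - P)" .
  then have "collinear {0, Q - P, R - P}" by (auto simp: collinear_lemma)
  then have "collinear {Q, P, R}" by (simp add: collinear_3)
  then show ?thesis by (simp add: insert_commute)
qed

lemma between_sgn:
  fixes A N D :: "'a :: real_normed_vector"
  assumes "N \<in> closed_segment A D" "N \<noteq> A" "N \<noteq> D"
  shows "sgn (A - N) = - sgn (D - N)"
proof -
  obtain u where u: "N = (1 - u) *\<^sub>R A + u *\<^sub>R D" "0 \<le> u" "u \<le> 1"
    using assms(1) by (auto simp: in_segment)
  then have "u > 0" "1 - u > 0" using assms(2,3) by (auto simp: less_le)
  moreover have "A - N = u *\<^sub>R (A - D)" "D - N = (1 - u) *\<^sub>R (- (A - D))"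
    by (simp_all add: u(1) algebra_simps)
  ultimately show ?thesis by (simp only: sgn_scaleR sgn_pos sgn_minus) simp
qed

text \<open>Both unit vectors change sign in passing to the vertical angle, so \<open>k\<close> is
  the same for the two triangles, and the half-angle equations give equal ratios of exradius to
  semiperimeter.\<close>

lemma exradius_vertical_angles:
  fixes A B D E N :: point
  assumes "exradius N B D r" "exradius N A E r'"
    and "N \<in> closed_segment A D" "N \<in> closed_segment B E"
    and "N \<noteq> A" "N \<noteq> B" "N \<noteq> D" "N \<noteq> E" "\<not> collinear {N, B, D}"
  shows "r * (dist N A + dist N E + dist A E) = r' * (dist N B + dist N D + dist B D)"
proof -
  define s where "s = (dist N B + dist N D + dist B D) / 2"
  define s' where "s' = (dist N A + dist N E + dist A E) / 2"
  define k where "k = sgn (B - N) \<bullet> sgn (D - N)"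
  have sg: "sgn (A - N) = - sgn (D - N)" "sgn (B - N) = - sgn (E - N)"
    using assms by (auto intro!: between_sgn)
  have ne: "sgn (B - N) \<noteq> sgn (D - N)" using assms sgn_eq_imp_collinear by blast
  then have ne': "sgn (A - N) \<noteq> sgn (E - N)" using sg by (metis minus_minus)
  have k': "sgn (A - N) \<bullet> sgn (E - N) = k" using sg by (simp add: k_def inner_commute)
  note r = exradius_half_angle[OF assms(1,6,7) ne, folded s_def k_def]
  note r' = exradius_half_angle[OF assms(2,5,8) ne', folded s'_def, unfolded k']
  have "(r * s')\<^sup>2 * (1 + k) = s'\<^sup>2 * (s\<^sup>2 * (1 - k))"
    using r(3) by (simp add: power_mult_distrib)
  also have "\<dots> = (r' * s)\<^sup>2 * (1 + k)" using r'(3) by (simp add: power_mult_distrib)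
  finally have "(r * s')\<^sup>2 = (r' * s)\<^sup>2" using r(2) by simp
  moreover have "r * s' \<ge> 0" "r' * s \<ge> 0" using r(1) r'(1) by (simp_all add: s_def s'_def)
  ultimately have "r * s' = r' * s" by (metis power2_eq_iff_nonneg)
  then show ?thesis by (simp add: s_def s'_def)
qed

section \<open>Barycentric coordinates of the Nagel point\<close>

text \<open>Affine independence of the vertices: moving the origin to \<open>A\<close> leaves a
  relation between \<open>B - A\<close> and \<open>C - A\<close>, which are linearly
  independent.\<close>

lemma barycentric_zero:
  fixes A B C :: "'a :: real_inner"
  assumes "\<not> collinear {A, B, C}" "\<alpha> *\<^sub>R A + \<beta> *\<^sub>R B + \<gamma> *\<^sub>R C = 0" "\<alpha> + \<beta> + \<gamma> = 0"
  shows "\<alpha> = 0" "\<beta> = 0" "\<gamma> = 0"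
proof -
  have "\<not> collinear {0, B - A, C - A}"
    using assms(1) collinear_3[of B A C] by (simp add: insert_commute)
  then have nc: "B - A \<noteq> 0" "C - A \<noteq> c *\<^sub>R (B - A)" for c
    unfolding collinear_lemma by auto
  have \<alpha>: "\<alpha> = - \<beta> - \<gamma>" using assms(3) by simp
  have eq: "\<beta> *\<^sub>R (B - A) + \<gamma> *\<^sub>R (C - A) = 0"
    using assms(2) unfolding \<alpha> by (simp add: algebra_simps)
  show "\<gamma> = 0"
  proof (rule ccontr)
    assume "\<gamma> \<noteq> 0"
    have "\<gamma> *\<^sub>R (C - A) = (- \<beta>) *\<^sub>R (B - A)"
      using eq by (simp add: eq_neg_iff_add_eq_0 add.commute)
    then have "C - A = (- \<beta> / \<gamma>) *\<^sub>R (B - A)"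
      using \<open>\<gamma> \<noteq> 0\<close> by (metis divide_inverse mult.commute scaleR_scaleR scaleR_one left_inverse)
    with nc show False by blast
  qed
  with eq nc show "\<beta> = 0" by simp
  with \<open>\<gamma> = 0\<close> show "\<alpha> = 0" using \<alpha> by simp
qed

lemma barycentric_unique:
  fixes A B C :: "'a :: real_inner"
  assumes "\<not> collinear {A, B, C}" "\<alpha> + \<beta> + \<gamma> = \<alpha>' + \<beta>' + \<gamma>'"
    and "\<alpha> *\<^sub>R A + \<beta> *\<^sub>R B + \<gamma> *\<^sub>R C = \<alpha>' *\<^sub>R A + \<beta>' *\<^sub>R B + \<gamma>' *\<^sub>R C"
  shows "\<alpha> = \<alpha>'" "\<beta> = \<beta>'" "\<gamma> = \<gamma>'"
proof -
  have "(\<alpha> - \<alpha>') *\<^sub>R A + (\<beta> - \<beta>') *\<^sub>R B + (\<gamma> - \<gamma>') *\<^sub>R C = 0"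
    "\<alpha> - \<alpha>' + (\<beta> - \<beta>') + (\<gamma> - \<gamma>') = 0"
    using assms(2,3) by (simp_all add: algebra_simps)
  from barycentric_zero[OF assms(1) this] show "\<alpha> = \<alpha>'" "\<beta> = \<beta>'" "\<gamma> = \<gamma>'" by simp_all
qed

text \<open>Equality would put \<open>A\<close> between \<open>B\<close> and \<open>C\<close>. The
  strictness makes the tangent lengths \<open>x, y, z\<close> positive.\<close>

lemma dist_triangle_strict:
  fixes A B C :: "'a :: euclidean_space"
  assumes "\<not> collinear {A, B, C}"
  shows "dist B C < dist C A + dist A B"
proof -
  have "\<not> between (B, C) A"
    using assms between_imp_collinear[of B C A] by (auto simp: insert_commute)
  then show ?thesis
    using dist_triangle[of B C A] by (simp add: between dist_commute add.commute)
qed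

text \<open>Equality of the two tangents from \<open>P\<close> determines \<open>dist Q T\<close>,
  and with it the position of \<open>T\<close> on the segment. The factor
  \<open>2 * dist Q R\<close> avoids a quotient.\<close>

lemma extouch_point_barycentric:
  assumes "extouch_point P Q R T"
  shows "(2 * dist Q R) *\<^sub>R T = (dist R P + dist Q R - dist P Q) *\<^sub>R R
    + (dist P Q + dist Q R - dist R P) *\<^sub>R Q"
proof -
  obtain z r where ex: "excircle_at P Q R z r T" using assms by (auto simp: extouch_point_def)
  have "dist P Q + dist Q T = dist P R + dist R T" "dist Q T + dist R T = dist Q R"
    using excircle_at_tangent_lengths[OF ex] by metis+
  then have QT: "2 * dist Q T = dist R P + dist Q R - dist P Q" by (simp add: dist_commute)
  obtain t where t: "T = (1 - t) *\<^sub>R Q + t *\<^sub>R R" "0 \<le> t"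
    using ex by (auto simp: excircle_at_def in_segment)
  have "T - Q = t *\<^sub>R (R - Q)" by (simp add: t(1) algebra_simps)
  then have "dist Q T = t * dist Q R"
    using t(2) by (metis abs_of_nonneg dist_commute dist_norm norm_scaleR)
  then have R: "dist R P + dist Q R - dist P Q = 2 * dist Q R * t"
    and Q: "dist P Q + dist Q R - dist R P = 2 * dist Q R * (1 - t)"
    using QT by (simp_all add: algebra_simps)
  show ?thesis unfolding R Q t(1) by (simp add: algebra_simps)
qed

text \<open>\<open>N\<close> is written along \<open>AD\<close> and along \<open>BE\<close>;
  uniqueness of barycentric coordinates then fixes its position on \<open>AD\<close>.\<close>

lemma nagel_point_barycentric:
  fixes A B C N :: point
  assumes nc: "\<not> collinear {A, B, C}" and N: "nagel_point A B C N"
  defines "x \<equiv> (dist C A + dist A B - dist B C) / 2"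
    and "y \<equiv> (dist A B + dist B C - dist C A) / 2"
    and "z \<equiv> (dist B C + dist C A - dist A B) / 2"
  shows "(x + y + z) *\<^sub>R N = x *\<^sub>R A + y *\<^sub>R B + z *\<^sub>R C"
proof -
  obtain D E where ex: "extouch_point A B C D" "extouch_point B C A E"
    and seg: "N \<in> closed_segment A D" "N \<in> closed_segment B E"
    using N by (auto simp: nagel_point_def)
  have pos: "x > 0" "y > 0" "z > 0"
    using dist_triangle_strict[of A B C] dist_triangle_strict[of B C A]
      dist_triangle_strict[of C A B] nc
    by (auto simp: x_def y_def z_def insert_commute)
  have sums: "dist B C = y + z" "dist C A = z + x" "dist A B = x + y"
    by (simp_all add: x_def y_def z_def field_simps)
  have "(2 * (y + z)) *\<^sub>R D = (2 * z) *\<^sub>R C + (2 * y) *\<^sub>R B"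
    "(2 * (z + x)) *\<^sub>R E = (2 * x) *\<^sub>R A + (2 * z) *\<^sub>R C"
    using ex[THEN extouch_point_barycentric] unfolding sums by (simp_all add: algebra_simps)
  then have "2 *\<^sub>R ((y + z) *\<^sub>R D) = 2 *\<^sub>R (y *\<^sub>R B + z *\<^sub>R C)"
    "2 *\<^sub>R ((z + x) *\<^sub>R E) = 2 *\<^sub>R (x *\<^sub>R A + z *\<^sub>R C)"
    by (simp_all add: scaleR_add_right)
  then have D: "(y + z) *\<^sub>R D = y *\<^sub>R B + z *\<^sub>R C" and E: "(z + x) *\<^sub>R E = x *\<^sub>R A + z *\<^sub>R C"
    by (simp_all only: scaleR_cancel_left) simp_all
  obtain u v where u: "N = (1 - u) *\<^sub>R A + u *\<^sub>R D" and v: "N = (1 - v) *\<^sub>R B + v *\<^sub>R E"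
    using seg unfolding in_segment by blast
  \<comment> \<open>The factor \<open>(y + z) * (z + x)\<close> clears the denominators of both
    \<open>D\<close> and \<open>E\<close>.\<close>
  have "((y + z) * (z + x)) *\<^sub>R N
      = ((y + z) * (z + x) * (1 - u)) *\<^sub>R A + (u * (z + x)) *\<^sub>R ((y + z) *\<^sub>R D)"
    by (subst u) (simp add: algebra_simps)
  moreover have "((y + z) * (z + x)) *\<^sub>R N
      = ((y + z) * (z + x) * (1 - v)) *\<^sub>R B + (v * (y + z)) *\<^sub>R ((z + x) *\<^sub>R E)"
    by (subst v) (simp add: algebra_simps)
  ultimately have "((y + z) * (z + x) * (1 - u)) *\<^sub>R A + (u * (z + x)) *\<^sub>R (y *\<^sub>R B + z *\<^sub>R C)
      = ((y + z) * (z + x) * (1 - v)) *\<^sub>R B + (v * (y + z)) *\<^sub>R (x *\<^sub>R A + z *\<^sub>R C)"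
    unfolding D E by simp
  then have eq: "((y + z) * (z + x) * (1 - u)) *\<^sub>R A + (u * (z + x) * y) *\<^sub>R B + (u * (z + x) * z) *\<^sub>R C
      = (v * (y + z) * x) *\<^sub>R A + ((y + z) * (z + x) * (1 - v)) *\<^sub>R B + (v * (y + z) * z) *\<^sub>R C"
    by (simp only: scaleR_add_right scaleR_scaleR ac_simps)
  have "(y + z) * (z + x) * (1 - u) + u * (z + x) * y + u * (z + x) * z
      = v * (y + z) * x + (y + z) * (z + x) * (1 - v) + v * (y + z) * z"
    by algebra
  from barycentric_unique[OF nc this eq]
  have "(y + z) * (z + x) * (1 - u) = v * (y + z) * x" "u * (z + x) * z = v * (y + z) * z"
    by simp_all
  then have "(z + x) * (1 - u) = v * x" and uv: "u * (z + x) = v * (y + z)"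
    using pos by simp_all
  \<comment> \<open>\<open>v\<close> is eliminated by multiplying the first equation by
    \<open>y + z\<close> and the second by \<open>x\<close>.\<close>
  then have "((x + y + z) * u - (y + z)) * (z + x) = 0" by algebra
  then have "(x + y + z) * u = y + z" using pos by simp
  then have "(x + y + z) *\<^sub>R N = x *\<^sub>R A + (y + z) *\<^sub>R D"
    unfolding u by (simp add: scaleR_add_right right_diff_distrib)
  then show ?thesis by (simp add: D)
qed

section \<open>Feet and lengths of the cevians\<close>

text \<open>\<open>D\<close> is given only by incidence; comparing coordinates of \<open>N\<close>
  recovers the ratios on \<open>BC\<close> and on \<open>AD\<close>. The weights are arbitrary
  positive numbers, so that all three cevians are covered by rotating the vertices. The last facts
  make the small triangles nondegenerate.\<close>

lemma cevian_foot:
  fixes A B C D N :: "'a :: euclidean_space"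
  assumes nc: "\<not> collinear {A, B, C}" and pos: "x > 0" "y > 0" "z > 0"
    and N: "(x + y + z) *\<^sub>R N = x *\<^sub>R A + y *\<^sub>R B + z *\<^sub>R C"
    and D: "D \<in> closed_segment B C" "N \<in> closed_segment A D"
  shows "(y + z) *\<^sub>R D = y *\<^sub>R B + z *\<^sub>R C"
    and "(x + y + z) * dist N A = (y + z) * dist A D"
    and "(x + y + z) * dist N D = x * dist A D"
    and "(y + z) * dist B D = z * dist B C"
    and "(y + z) * dist C D = y * dist B C"
    and "N \<noteq> A" "N \<noteq> D" "\<not> collinear {N, B, D}" "\<not> collinear {N, C, D}"
proof -
  obtain t u where t: "D = (1 - t) *\<^sub>R B + t *\<^sub>R C" and u: "N = (1 - u) *\<^sub>R A + u *\<^sub>R D"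
    using D by (auto simp: in_segment)
  have eq: "((x + y + z) * (1 - u)) *\<^sub>R A + ((x + y + z) * (u * (1 - t))) *\<^sub>R B
      + ((x + y + z) * (u * t)) *\<^sub>R C = x *\<^sub>R A + y *\<^sub>R B + z *\<^sub>R C"
    using N unfolding u t by (simp add: algebra_simps)
  have "(x + y + z) * (1 - u) + (x + y + z) * (u * (1 - t)) + (x + y + z) * (u * t) = x + y + z"
    by algebra
  note e = barycentric_unique[OF nc this eq]
  \<comment> \<open>Once \<open>A\<close> has taken weight \<open>x\<close>, the foot
    \<open>D\<close> carries the remaining weight \<open>y + z\<close>.\<close>
  have "(x + y + z) * u = (x + y + z) - (x + y + z) * (1 - u)" by algebra
  then have su: "(x + y + z) * u = y + z" unfolding e(1) by simp
  have yz: "(y + z) * t = z" "(y + z) * (1 - t) = y"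
    using e(2,3) unfolding su[symmetric] mult.assoc by simp_all
  show foot: "(y + z) *\<^sub>R D = y *\<^sub>R B + z *\<^sub>R C"
    unfolding t using yz by (simp add: scaleR_add_right)
  have abs: "c * dist P Q = d * dist S R"
    if "c *\<^sub>R (P - Q) = d *\<^sub>R (R - S)" "c > 0" "d > 0" for c d :: real and P Q R S :: 'a
    using arg_cong[OF that(1), of norm] that(2,3) by (simp add: dist_norm norm_minus_commute)
  have sum_pos: "x + y + z > 0" "y + z > 0" using pos by simp_all
  have "(x + y + z) *\<^sub>R (N - A) = ((x + y + z) * u) *\<^sub>R (D - A)"
    "(x + y + z) *\<^sub>R (N - D) = ((x + y + z) * (1 - u)) *\<^sub>R (A - D)"
    by (simp_all add: u algebra_simps)
  then have vN: "(x + y + z) *\<^sub>R (N - A) = (y + z) *\<^sub>R (D - A)"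
    "(x + y + z) *\<^sub>R (N - D) = x *\<^sub>R (A - D)"
    unfolding su e(1) .
  show NA: "(x + y + z) * dist N A = (y + z) * dist A D"
    by (rule abs[OF vN(1) sum_pos])
  show ND: "(x + y + z) * dist N D = x * dist A D"
    using abs[OF vN(2) sum_pos(1) pos(1)] by (simp add: dist_commute)
  have "(y + z) *\<^sub>R (B - D) = ((y + z) * t) *\<^sub>R (B - C)"
    "(y + z) *\<^sub>R (C - D) = ((y + z) * (1 - t)) *\<^sub>R (C - B)"
    by (simp_all add: t algebra_simps)
  then have vD: "(y + z) *\<^sub>R (B - D) = z *\<^sub>R (B - C)" "(y + z) *\<^sub>R (C - D) = y *\<^sub>R (C - B)"
    unfolding yz .
  show BD: "(y + z) * dist B D = z * dist B C"
    using abs[OF vD(1) sum_pos(2) pos(3)] by (simp add: dist_commute)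
  show CD: "(y + z) * dist C D = y * dist B C"
    by (rule abs[OF vD(2) sum_pos(2) pos(2)])
  have "B \<noteq> C" using nc by auto
  then have ne: "B \<noteq> D" "C \<noteq> D" using BD CD pos by auto
  have seg: "collinear {P, X, Q}" if "X \<in> closed_segment P Q" for P Q X :: 'a
    using that between_imp_collinear[of P Q X] by (simp add: between_mem_segment insert_commute)
  have "A \<noteq> D" using nc seg[OF D(1)] by (auto simp: insert_commute)
  then show nAD: "N \<noteq> A" "N \<noteq> D" using NA ND pos by auto
  have col: "collinear {D, B, C}" "collinear {A, D, N}"
    using D[THEN seg] by (simp_all add: insert_commute)
  \<comment> \<open>Such a collinearity would put \<open>X\<close> on the line \<open>AD\<close>,
    and then \<open>A\<close> on the line \<open>BC\<close>. The names \<open>X\<close>,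
    \<open>Y\<close> stand for \<open>B\<close>, \<open>C\<close> in either order.\<close>
  have *: False if N: "collinear {N, X, D}" and X: "X \<noteq> D" "collinear {X, D, Y}" and "{X, Y} = {B, C}"
    for X Y
  proof -
    have "collinear {A, D, X}"
      using collinear_3_trans[of A D N X] N col nAD by (simp add: insert_commute)
    then have "collinear {A, X, Y}"
      using collinear_3_trans[of A X D Y] X by (simp add: insert_commute)
    then show False using nc \<open>{X, Y} = {B, C}\<close> by simp
  qed
  show "\<not> collinear {N, B, D}" "\<not> collinear {N, C, D}"
    using *[of B C] *[of C B] ne col by (auto simp: insert_commute)
qed

text \<open>With the origin at \<open>A\<close>, the square of \<open>y b + z c\<close> is expanded
  and its mixed term expressed through \<open>|b - c|^2\<close>.\<close>

lemma stewart:
  fixes A B C D :: "'a :: real_inner"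
  assumes "(y + z) *\<^sub>R D = y *\<^sub>R B + z *\<^sub>R C"
  shows "(y + z)\<^sup>2 * (dist A D)\<^sup>2
    = (y + z) * (y * (dist A B)\<^sup>2 + z * (dist A C)\<^sup>2) - y * z * (dist B C)\<^sup>2"
proof -
  define b c where "b = B - A" and "c = C - A"
  have AD: "(y + z) *\<^sub>R (D - A) = y *\<^sub>R b + z *\<^sub>R c"
    using assms by (simp add: b_def c_def algebra_simps)
  have bc: "B - C = b - c" by (simp add: b_def c_def)
  have "(y + z)\<^sup>2 * (dist A D)\<^sup>2 = ((y + z) *\<^sub>R (D - A)) \<bullet> ((y + z) *\<^sub>R (D - A))"
    unfolding dist_norm norm_minus_commute[of A] power2_norm_eq_inner
    by (simp add: power2_eq_square)
  also have "\<dots> = (y + z) * (y * (b \<bullet> b) + z * (c \<bullet> c)) - y * z * ((b - c) \<bullet> (b - c))"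
    unfolding AD
    by (simp add: inner_add_left inner_add_right inner_diff_left inner_diff_right inner_commute
        algebra_simps)
  also have "\<dots> = (y + z) * (y * (dist A B)\<^sup>2 + z * (dist A C)\<^sup>2) - y * z * (dist B C)\<^sup>2"
    unfolding bc[symmetric] b_def c_def
    by (simp add: dist_norm norm_minus_commute flip: power2_norm_eq_inner)
  finally show ?thesis .
qed

text \<open>In Stewart's theorem put \<open>dist A B = s - z\<close> and
  \<open>dist A C = s - y\<close> with \<open>s = x + y + z\<close>: the terms
  \<open>y z (y + z)\<close> cancel, and a common factor \<open>y + z\<close> can be
  removed.\<close>

lemma nagel_cevian_length:
  fixes A B C D :: "'a :: real_inner"
  assumes "(y + z) *\<^sub>R D = y *\<^sub>R B + z *\<^sub>R C" "y > 0" "z > 0"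
    and "dist B C = y + z" "dist C A = z + x" "dist A B = x + y"
  shows "(y + z) * (dist A D)\<^sup>2 = (x + y + z) * ((x + y + z) * (y + z) - 4 * y * z)"
proof -
  have "(y + z) * ((y + z) * (dist A D)\<^sup>2)
      = (y + z) * ((x + y + z) * ((x + y + z) * (y + z) - 4 * y * z))"
    using stewart[OF assms(1), of A] unfolding dist_commute[of A C] assms(4-6)
    by (simp add: algebra_simps power2_eq_square)
  then show ?thesis using assms(2,3) by simp
qed

text \<open>Here \<open>p, q, r\<close> are the lengths of the cevians from \<open>A, B, C\<close>, and every factor is \<open>s = x + y + z\<close>
  times the perimeter of one of the six triangles.\<close>

lemma nagel_perimeter_identity:
  fixes x y z p q r :: real
  assumes "s = x + y + z"
    and "(y + z) * p\<^sup>2 = s * (s * (y + z) - 4 * y * z)"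
    and "(z + x) * q\<^sup>2 = s * (s * (z + x) - 4 * z * x)"
    and "(x + y) * r\<^sup>2 = s * (s * (x + y) - 4 * x * y)"
  shows "(q * (z + x) + p * x + s * z) * (r * (x + y) + q * y + s * x) * (p * (y + z) + r * z + s * y)
    = (r * (x + y) + p * x + s * y) * (p * (y + z) + q * y + s * z) * (q * (z + x) + r * z + s * x)"
  \<comment> \<open>In the expansion each squared cevian carries the factor it has in its
    hypothesis, such as \<open>y + z\<close> for \<open>p\<close>. Replacing these squares makes the
    linear terms agree; the products of distinct cevians agree already.\<close>
  using assms by algebra

section \<open>The product of the exradii\<close>

theorem theorem5p2:
  fixes A B C N D E F :: point
    and r1 r2 r3 r4 r5 r6 :: real
  assumes "\<not> collinear {A, B, C}"
    and "nagel_point A B C N"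
    and "D \<in> closed_segment B C" and "N \<in> closed_segment A D"
    and "E \<in> closed_segment C A" and "N \<in> closed_segment B E"
    and "F \<in> closed_segment A B" and "N \<in> closed_segment C F"
    and "exradius N B D r1"
    and "exradius N C D r2"
    and "exradius N C E r3"
    and "exradius N A E r4"
    and "exradius N A F r5"
    and "exradius N B F r6"
  shows "r1 * r3 * r5 = r2 * r4 * r6"
proof -
  define x y z where "x = (dist C A + dist A B - dist B C) / 2"
    and "y = (dist A B + dist B C - dist C A) / 2"
    and "z = (dist B C + dist C A - dist A B) / 2"
  define s where "s = x + y + z"
  have sums: "dist B C = y + z" "dist C A = z + x" "dist A B = x + y"
    by (simp_all add: x_def y_def z_def field_simps)
  have nc: "\<not> collinear {A, B, C}" "\<not> collinear {B, C, A}" "\<not> collinear {C, A, B}"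
    using assms(1) by (simp_all add: insert_commute)
  have pos: "x > 0" "y > 0" "z > 0"
    using nc[THEN dist_triangle_strict] by (auto simp: x_def y_def z_def)
  have N: "(x + y + z) *\<^sub>R N = x *\<^sub>R A + y *\<^sub>R B + z *\<^sub>R C"
    using nagel_point_barycentric[OF assms(1,2)] by (simp add: x_def y_def z_def)
  then have N': "(y + z + x) *\<^sub>R N = y *\<^sub>R B + z *\<^sub>R C + x *\<^sub>R A"
    "(z + x + y) *\<^sub>R N = z *\<^sub>R C + x *\<^sub>R A + y *\<^sub>R B" by (simp_all add: ac_simps)
  \<comment> \<open>Rotating the vertices rotates the weights, hence the cyclic rewritings of the
    equation for \<open>N\<close>.\<close>
  note D = cevian_foot[OF nc(1) pos N assms(3,4)]
  note E = cevian_foot[OF nc(2) pos(2,3,1) N'(1) assms(5,6)]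
  note F = cevian_foot[OF nc(3) pos(3,1,2) N'(2) assms(7,8)]
  define p q r where "p = dist A D" and "q = dist B E" and "r = dist C F"
  have s: "s > 0" "y + z + x = s" "z + x + y = s" using pos by (simp_all add: s_def)
  have pqr: "(y + z) * p\<^sup>2 = s * (s * (y + z) - 4 * y * z)"
    "(z + x) * q\<^sup>2 = s * (s * (z + x) - 4 * z * x)"
    "(x + y) * r\<^sup>2 = s * (s * (x + y) - 4 * x * y)"
    using nagel_cevian_length[OF D(1) pos(2,3) sums] nagel_cevian_length[OF E(1) pos(3,1) sums(2,3,1)]
      nagel_cevian_length[OF F(1) pos(1,2) sums(3,1,2)]
    unfolding p_def q_def r_def s s_def[symmetric] .
  \<comment> \<open>Each side is the sum of the weights at its ends, so the ratios become lengths: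
    the part at \<open>B\<close> is the weight \<open>z\<close> of \<open>C\<close>, as for the
    excircle contact point.\<close>
  have lens: "dist B D = z" "dist C D = y" "dist C E = x" "dist A E = z" "dist A F = y" "dist B F = x"
    using D(4,5) E(4,5) F(4,5) pos unfolding sums by auto
  define s1 s2 s3 s4 s5 s6 where
    "s1 = dist N B + dist N D + dist B D" and "s2 = dist N C + dist N D + dist C D"
    and "s3 = dist N C + dist N E + dist C E" and "s4 = dist N A + dist N E + dist A E"
    and "s5 = dist N A + dist N F + dist A F" and "s6 = dist N B + dist N F + dist B F"
  \<comment> \<open>The vertical pairs at \<open>N\<close> are \<open>BND\<close> and
    \<open>ANE\<close>, \<open>CNE\<close> and \<open>BNF\<close>, \<open>ANF\<close> and
    \<open>CND\<close>; each joins a radius of the left product to one of the right.\<close>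
  have vert: "r1 * s4 = r4 * s1" "r3 * s6 = r6 * s3" "r5 * s2 = r2 * s5"
    unfolding s1_def s2_def s3_def s4_def s5_def s6_def
    using exradius_vertical_angles[OF assms(9,12,4,6) D(6) E(6) D(7) E(7) D(8)]
      exradius_vertical_angles[OF assms(11,14,6,8) E(6) F(6) E(7) F(7) E(8)]
      exradius_vertical_angles[OF assms(13,10,8,4) F(6) D(6) F(7) D(7) F(8)]
    by simp_all
  have NX: "s * dist N A = p * (y + z)" "s * dist N D = p * x"
    "s * dist N B = q * (z + x)" "s * dist N E = q * y"
    "s * dist N C = r * (x + y)" "s * dist N F = r * z"
    using D(2,3) E(2,3) F(2,3) unfolding p_def q_def r_def s s_def[symmetric]
    by (simp_all add: mult.commute)
  have scaled: "s * s1 = q * (z + x) + p * x + s * z" "s * s3 = r * (x + y) + q * y + s * x"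
    "s * s5 = p * (y + z) + r * z + s * y" "s * s2 = r * (x + y) + p * x + s * y"
    "s * s4 = p * (y + z) + q * y + s * z" "s * s6 = q * (z + x) + r * z + s * x"
    unfolding s1_def s2_def s3_def s4_def s5_def s6_def lens distrib_left[of s] NX by (rule refl)+
  have "(s * s1) * (s * s3) * (s * s5) = (s * s2) * (s * s4) * (s * s6)"
    unfolding scaled by (rule nagel_perimeter_identity[OF s_def pqr])
  then have "s ^ 3 * (s1 * s3 * s5) = s ^ 3 * (s2 * s4 * s6)" by algebra
  then have perim: "s1 * s3 * s5 = s2 * s4 * s6" using s(1) by simp
  have "s2 * s4 * s6 > 0"
    unfolding s2_def s4_def s6_def lens using pos by (simp add: add_nonneg_pos)
  \<comment> \<open>Each radius is grouped with the perimeter of its vertical partner, so that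
    \<open>vert\<close> swaps the two radius products; the positive perimeter product then
    cancels.\<close>
  moreover have "(r1 * r3 * r5) * (s2 * s4 * s6) = (r1 * s4) * (r3 * s6) * (r5 * s2)" by algebra
  then have "(r1 * r3 * r5) * (s2 * s4 * s6) = (r2 * r4 * r6) * (s1 * s3 * s5)"
    unfolding vert by algebra
  ultimately show ?thesis unfolding perim by (metis less_irrefl mult_right_cancel)
qed

end
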